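(* Let $f\colon X\to U$ be an i-homomorphism of solutions $(X,r)$ and $(U,s)$ with i-kernel $X_0$, and let $\bar f\colon G_X\to G_U$ be the induced homomorphism of structure skew braces. Then: 1. $\langle X_0\rangle_{\cdot}=\langle X_0\rangle_+$, and this is a strong left ideal of $G_X$; 2. $I^f_{X_0}:=\langle X_0\rangle_{\cdot}\operatorname{Ker}\bar f=\langle X_0\rangle_++\operatorname{Ker}\bar f$ is an ideal of $G_X$; 3. for every $x,y\in X$ with $f(x)=f(y)$, one has $xI^f_{X_0}=yI^f_{X_0}$; 4. if the canonical map $\iota_U\colon U\to G_U$ is injective, then the converse of item 3 also holds: for every $x,y\in X$, $xI^f_{X_0}=yI^f_{X_0}$ implies $f(x)=f(y)$.
   Context: **Solutions.** A solution (of the Yang-Baxter equation) is a pair $(X,r)$ with $X$ a nonempty set and $r\colon X\times X\to X\times X$ a map satisfying $(r\times\mathrm{id})(\mathrm{id}\times r)(r\times\mathrm{id})=(\mathrm{id}\times r)(r\times\mathrm{id})(\mathrm{id}\times r)$. Write $r(x,y)=(\lambda_x(y),\rho_y(x))$. All solutions are assumed non-degenerate: $\lambda_x$ and $\rho_x$ are bijective for every $x\in X$ (it is known that $r$ is then bijective). **Skew braces.** A skew brace is $(B,+,\cdot)$ where $(B,+)$ and $(B,\cdot)$ are (not necessarily abelian) groups and $a(b+c)=ab-a+ac$ for all $a,b,c$; both groups have the same identity, denoted $0$. Put $\lambda_a(b)=-a+ab$ and $\rho_b(a)=\lambda_a(b)^{-1}ab$; the associated solution is $(B,r_B)$, $r_B(a,b)=(\lambda_a(b),\rho_b(a))$.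 A left ideal is a subgroup of $(B,+)$ invariant under all $\lambda_a$, $a\in B$; it is a strong left ideal if it is moreover normal in $(B,+)$. An ideal is a strong left ideal that is also a normal subgroup of $(B,\cdot)$. $\langle S\rangle_{\cdot}$ and $\langle S\rangle_+$ denote the subgroups generated by $S$ in $(B,\cdot)$ and $(B,+)$. The kernel of a skew brace homomorphism $g$ is $\operatorname{Ker}g=\{a\mid g(a)=0\}$. **Structure skew brace.** For a solution $(X,r)$, $(G_X,\cdot)=\langle X\mid xy=\lambda_x(y)\rho_y(x),\ x,y\in X\rangle$, with canonical map $\iota_X\colon X\to G_X$ (not necessarily injective). There is a unique addition making $(G_X,+,\cdot)$ a skew brace such that $r_{G_X}(\iota_X\times\iota_X)=(\iota_X\times\iota_X)r$; this is the structure skew brace of $(X,r)$. Elements $x\in X$ and subsets of $X$ are regarded in $G_X$ through $\iota_X$ (so $\langle X_0\rangle_{\cdot}$ means $\langle\iota_X(X_0)\rangle_{\cdot}$ and $xI$ means $\iota_X(x)I$). **Homomorphisms and i-homomorphisms.** A homomorphism of solutions $(X,r)\to(U,s)$ is a map $f\colon X\to U$ with $(f\times f)r=s(f\times f)$. It induces a unique skew brace homomorphism $\bar f\colon G_X\to G_U$ with $\bar f\iota_X=\iota_U f$. $\ker f$ denotes the equivalence relation $x(\ker f)y\iff f(x)=f(y)$ on $X$. $f$ is an i-homomorphism if there is an equivalence class $X_0\subseteq X$ of $\ker f$ such that $r(X_0\times Z)=Z\times X_0$ and $r(Z\times X_0)=X_0\times Z$ for every equivalence class $Z$ of $\ker f$;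 such an $X_0$ is called an i-kernel of $f$. *)

theory Defs
  imports "HOL-Algebra.Generated_Groups" "HOL-Algebra.AbelCoset"
begin

section \<open>Solutions of the Yang-Baxter equation\<close>

text \<open>
  The underlying set of a solution is a whole type, hence nonempty. With
  \<open>r (x, y) = (sol_lambda r x y, sol_rho r y x)\<close> the index of each of the two
  families of maps is the first argument after \<open>r\<close>. Triples are nested to the right, so
  \<open>yb_left r\<close> and \<open>yb_right r\<close> are \<open>r \<times> id\<close> and \<open>id \<times> r\<close>.
\<close>

definition sol_lambda :: "('x \<times> 'x \<Rightarrow> 'x \<times> 'x) \<Rightarrow> 'x \<Rightarrow> 'x \<Rightarrow> 'x" where
  "sol_lambda r x y = fst (r (x, y))"

definition sol_rho :: "('x \<times> 'x \<Rightarrow> 'x \<times> 'x) \<Rightarrow> 'x \<Rightarrow> 'x \<Rightarrow> 'x" where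
  "sol_rho r y x = snd (r (x, y))"

definition yb_left :: "('x \<times> 'x \<Rightarrow> 'x \<times> 'x) \<Rightarrow> 'x \<times> 'x \<times> 'x \<Rightarrow> 'x \<times> 'x \<times> 'x" where
  "yb_left r = (\<lambda>(x, y, z). case r (x, y) of (u, v) \<Rightarrow> (u, v, z))"

definition yb_right :: "('x \<times> 'x \<Rightarrow> 'x \<times> 'x) \<Rightarrow> 'x \<times> 'x \<times> 'x \<Rightarrow> 'x \<times> 'x \<times> 'x" where
  "yb_right r = map_prod id r"

definition yb_solution :: "('x \<times> 'x \<Rightarrow> 'x \<times> 'x) \<Rightarrow> bool" where
  "yb_solution r \<longleftrightarrow>
     yb_left r \<circ> yb_right r \<circ> yb_left r = yb_right r \<circ> yb_left r \<circ> yb_right r \<and>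
     (\<forall>x. bij (sol_lambda r x)) \<and> (\<forall>x. bij (sol_rho r x))"

definition sol_hom ::
  "('x \<times> 'x \<Rightarrow> 'x \<times> 'x) \<Rightarrow> ('u \<times> 'u \<Rightarrow> 'u \<times> 'u) \<Rightarrow> ('x \<Rightarrow> 'u) \<Rightarrow> bool" where
  "sol_hom r s f \<longleftrightarrow> map_prod f f \<circ> r = s \<circ> map_prod f f"

definition ker_rel :: "('x \<Rightarrow> 'u) \<Rightarrow> ('x \<times> 'x) set" where
  "ker_rel f = {(x, y). f x = f y}"

definition i_kernel :: "('x \<times> 'x \<Rightarrow> 'x \<times> 'x) \<Rightarrow> ('x \<Rightarrow> 'u) \<Rightarrow> 'x set \<Rightarrow> bool" where
  "i_kernel r f X0 \<longleftrightarrow> X0 \<in> UNIV // ker_rel f \<and>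
     (\<forall>Z \<in> UNIV // ker_rel f. r ` (X0 \<times> Z) = Z \<times> X0 \<and> r ` (Z \<times> X0) = X0 \<times> Z)"

definition i_hom ::
  "('x \<times> 'x \<Rightarrow> 'x \<times> 'x) \<Rightarrow> ('u \<times> 'u \<Rightarrow> 'u \<times> 'u) \<Rightarrow> ('x \<Rightarrow> 'u) \<Rightarrow> bool" where
  "i_hom r s f \<longleftrightarrow> sol_hom r s f \<and> (\<exists>X0. i_kernel r f X0)"


section \<open>Skew braces\<close>

text \<open>
  A skew brace is carried by a ring record, whose operations need not form a ring:
  \<^term>\<open>add_monoid B\<close> is the additive group, \<^term>\<open>B\<close> itself (as a monoid record) is the
  multiplicative group.
\<close>

definition skew_brace :: "('a, 'm) ring_scheme \<Rightarrow> bool" where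
  "skew_brace B \<longleftrightarrow> group B \<and> group (add_monoid B) \<and>
     (\<forall>a \<in> carrier B. \<forall>b \<in> carrier B. \<forall>c \<in> carrier B.
        a \<otimes>\<^bsub>B\<^esub> (b \<oplus>\<^bsub>B\<^esub> c) = (a \<otimes>\<^bsub>B\<^esub> b) \<ominus>\<^bsub>B\<^esub> a \<oplus>\<^bsub>B\<^esub> (a \<otimes>\<^bsub>B\<^esub> c))"

definition brace_lambda :: "('a, 'm) ring_scheme \<Rightarrow> 'a \<Rightarrow> 'a \<Rightarrow> 'a" where
  "brace_lambda B a b = (\<ominus>\<^bsub>B\<^esub> a) \<oplus>\<^bsub>B\<^esub> (a \<otimes>\<^bsub>B\<^esub> b)"

definition brace_rho :: "('a, 'm) ring_scheme \<Rightarrow> 'a \<Rightarrow> 'a \<Rightarrow> 'a" where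
  "brace_rho B b a = (inv\<^bsub>B\<^esub> (brace_lambda B a b)) \<otimes>\<^bsub>B\<^esub> (a \<otimes>\<^bsub>B\<^esub> b)"

definition brace_sol :: "('a, 'm) ring_scheme \<Rightarrow> 'a \<times> 'a \<Rightarrow> 'a \<times> 'a" where
  "brace_sol B = (\<lambda>(a, b). (brace_lambda B a b, brace_rho B b a))"

definition left_ideal :: "('a, 'm) ring_scheme \<Rightarrow> 'a set \<Rightarrow> bool" where
  "left_ideal B L \<longleftrightarrow> subgroup L (add_monoid B) \<and>
     (\<forall>a \<in> carrier B. brace_lambda B a ` L \<subseteq> L)"

definition strong_left_ideal :: "('a, 'm) ring_scheme \<Rightarrow> 'a set \<Rightarrow> bool" where
  "strong_left_ideal B L \<longleftrightarrow> left_ideal B L \<and> L \<lhd> add_monoid B"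

definition brace_ideal :: "('a, 'm) ring_scheme \<Rightarrow> 'a set \<Rightarrow> bool" where
  "brace_ideal B I \<longleftrightarrow> strong_left_ideal B I \<and> I \<lhd> B"

definition brace_hom ::
  "('a, 'm) ring_scheme \<Rightarrow> ('b, 'n) ring_scheme \<Rightarrow> ('a \<Rightarrow> 'b) set" where
  "brace_hom B C = hom B C \<inter> hom (add_monoid B) (add_monoid C)"


section \<open>Groups given by generators and relations\<close>

text \<open>
  Words are lists of letters \<open>(x, True)\<close>, standing for the generator \<open>x\<close>, and
  \<open>(x, False)\<close>, standing for its inverse. A pair \<open>(u, v) \<in> R\<close> is the defining relation
  \<open>u = v\<close>. The presented group consists of the classes of words modulo the least
  congruence that contains \<open>R\<close> and makes \<open>(x, False)\<close> inverse to \<open>(x, True)\<close>.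
\<close>

type_synonym 'x word = "('x \<times> bool) list"

inductive word_cong :: "('x word \<times> 'x word) set \<Rightarrow> 'x word \<Rightarrow> 'x word \<Rightarrow> bool"
  for R where
  refl: "word_cong R u u"
| sym: "word_cong R u v \<Longrightarrow> word_cong R v u"
| trans: "word_cong R u v \<Longrightarrow> word_cong R v w \<Longrightarrow> word_cong R u w"
| append: "word_cong R u u' \<Longrightarrow> word_cong R v v' \<Longrightarrow> word_cong R (u @ v) (u' @ v')"
| cancel: "word_cong R [(x, b), (x, \<not> b)] []"
| relation: "(u, v) \<in> R \<Longrightarrow> word_cong R u v"

definition word_class :: "('x word \<times> 'x word) set \<Rightarrow> 'x word \<Rightarrow> 'x word set" where
  "word_class R u = {v. word_cong R u v}"

definition presented_group :: "('x word \<times> 'x word) set \<Rightarrow> 'x word set monoid" where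
  "presented_group R =
     \<lparr>carrier = range (word_class R),
      mult = (\<lambda>A B. {w. \<exists>u \<in> A. \<exists>v \<in> B. word_cong R (u @ v) w}),
      one = word_class R []\<rparr>"

lemma word_class_eq_iff: "word_class R u = word_class R v \<longleftrightarrow> word_cong R u v"
proof
  assume "word_class R u = word_class R v"
  moreover have "v \<in> word_class R v" by (simp add: word_class_def word_cong.refl)
  ultimately have "v \<in> word_class R u" by (simp only:)
  then show "word_cong R u v" by (simp add: word_class_def)
next
  assume uv: "word_cong R u v"
  have "word_cong R u w \<longleftrightarrow> word_cong R v w" for w
    using word_cong.trans[OF uv, of w] word_cong.trans[OF word_cong.sym[OF uv], of w] by argo
  then show "word_class R u = word_class R v" by (simp add: word_class_def)
qed

lemma mult_word_class:
  "word_class R u \<otimes>\<^bsub>presented_group R\<^esub> word_class R v = word_class R (u @ v)"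
proof -
  have "(\<exists>u'. word_cong R u u' \<and> (\<exists>v'. word_cong R v v' \<and> word_cong R (u' @ v') w)) \<longleftrightarrow>
      word_cong R (u @ v) w" for w
  proof
    assume "\<exists>u'. word_cong R u u' \<and> (\<exists>v'. word_cong R v v' \<and> word_cong R (u' @ v') w)"
    then obtain u' v' where *: "word_cong R u u'" "word_cong R v v'" "word_cong R (u' @ v') w"
      by auto
    show "word_cong R (u @ v) w"
      by (rule word_cong.trans[OF word_cong.append[OF *(1,2)] *(3)])
  next
    assume "word_cong R (u @ v) w"
    then show "\<exists>u'. word_cong R u u' \<and> (\<exists>v'. word_cong R v v' \<and> word_cong R (u' @ v') w)"
      using word_cong.refl[of R u] word_cong.refl[of R v] by blast
  qed
  then show ?thesis
    by (simp add: word_class_def presented_group_def)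
qed

lemma word_class_inverse:
  "word_cong R (rev (map (\<lambda>(x, b). (x, \<not> b)) u) @ u) []"
proof (induction u)
  case Nil
  then show ?case by (simp add: word_cong.refl)
next
  case (Cons a u)
  obtain x b where a: "a = (x, b)" by (cases a)
  let ?v = "rev (map (\<lambda>(x, b). (x, \<not> b)) u)"
  have "word_cong R [(x, \<not> b), (x, b)] []"
    using word_cong.cancel[of R x "\<not> b"] by simp
  then have "word_cong R (?v @ ([(x, \<not> b), (x, b)] @ u)) (?v @ ([] @ u))"
    by (intro word_cong.append word_cong.refl)
  then have "word_cong R (?v @ [(x, \<not> b), (x, b)] @ u) []"
    using word_cong.trans[OF _ Cons.IH] by simp
  then show ?case by (simp add: a)
qed

lemma group_presented_group: "group (presented_group R)"
proof (rule groupI)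
  show "\<one>\<^bsub>presented_group R\<^esub> \<in> carrier (presented_group R)"
    by (simp add: presented_group_def)
next
  fix A B assume "A \<in> carrier (presented_group R)" "B \<in> carrier (presented_group R)"
  then obtain u v where "A = word_class R u" "B = word_class R v"
    by (auto simp: presented_group_def)
  then have "A \<otimes>\<^bsub>presented_group R\<^esub> B = word_class R (u @ v)"
    by (simp add: mult_word_class)
  then show "A \<otimes>\<^bsub>presented_group R\<^esub> B \<in> carrier (presented_group R)"
    by (simp add: presented_group_def)
next
  fix A B C assume "A \<in> carrier (presented_group R)" "B \<in> carrier (presented_group R)"
    "C \<in> carrier (presented_group R)"
  then obtain u v w where "A = word_class R u" "B = word_class R v" "C = word_class R w"
    by (auto simp: presented_group_def)
  then show "A \<otimes>\<^bsub>presented_group R\<^esub> B \<otimes>\<^bsub>presented_group R\<^esub> C =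
      A \<otimes>\<^bsub>presented_group R\<^esub> (B \<otimes>\<^bsub>presented_group R\<^esub> C)"
    by (simp add: mult_word_class)
next
  have one: "\<one>\<^bsub>presented_group R\<^esub> = word_class R []" by (simp add: presented_group_def)
  fix A assume "A \<in> carrier (presented_group R)"
  then obtain u where A: "A = word_class R u"
    by (auto simp: presented_group_def)
  show "\<one>\<^bsub>presented_group R\<^esub> \<otimes>\<^bsub>presented_group R\<^esub> A = A"
    by (simp add: A one mult_word_class)
  have "word_class R (rev (map (\<lambda>(x, b). (x, \<not> b)) u)) \<otimes>\<^bsub>presented_group R\<^esub> A
      = \<one>\<^bsub>presented_group R\<^esub>"
    by (simp add: A one mult_word_class word_class_eq_iff word_class_inverse)
  then show "\<exists>B \<in> carrier (presented_group R). B \<otimes>\<^bsub>presented_group R\<^esub> A = \<one>\<^bsub>presented_group R\<^esub>"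
    by (auto simp: presented_group_def)
qed


section \<open>The structure skew brace of a solution\<close>

definition structure_relations ::
  "('x \<times> 'x \<Rightarrow> 'x \<times> 'x) \<Rightarrow> ('x word \<times> 'x word) set" where
  "structure_relations r =
     {([(x, True), (y, True)], [(sol_lambda r x y, True), (sol_rho r y x, True)]) | x y. True}"

definition structure_group :: "('x \<times> 'x \<Rightarrow> 'x \<times> 'x) \<Rightarrow> 'x word set monoid" where
  "structure_group r = presented_group (structure_relations r)"

definition canonical_map :: "('x \<times> 'x \<Rightarrow> 'x \<times> 'x) \<Rightarrow> 'x \<Rightarrow> 'x word set" where
  "canonical_map r x = word_class (structure_relations r) [(x, True)]"

text \<open>
  \<open>structure_skew_brace r G\<close> says that \<open>G\<close> is the structure group of \<open>r\<close> together with the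
  unique addition that makes it a skew brace whose associated solution restricts to \<open>r\<close>
  along the canonical map. It is a predicate because that addition is determined only on the
  carrier.
\<close>

definition structure_skew_brace ::
  "('x \<times> 'x \<Rightarrow> 'x \<times> 'x) \<Rightarrow> 'x word set ring \<Rightarrow> bool" where
  "structure_skew_brace r G \<longleftrightarrow>
     monoid.truncate G = structure_group r \<and> skew_brace G \<and>
     brace_sol G \<circ> map_prod (canonical_map r) (canonical_map r) =
       map_prod (canonical_map r) (canonical_map r) \<circ> r"

text \<open>
  \<open>induced_hom r s G H f g\<close>: on the carrier of \<open>G\<close>, \<open>g\<close> is the unique skew brace
  homomorphism induced by \<open>f\<close>.
\<close>

definition induced_hom ::
  "('x \<times> 'x \<Rightarrow> 'x \<times> 'x) \<Rightarrow> ('u \<times> 'u \<Rightarrow> 'u \<times> 'u) \<Rightarrow> 'x word set ring \<Rightarrow> 'u word set ring \<Rightarrow>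
    ('x \<Rightarrow> 'u) \<Rightarrow> ('x word set \<Rightarrow> 'u word set) \<Rightarrow> bool" where
  "induced_hom r s G H f g \<longleftrightarrow>
     g \<in> brace_hom G H \<and> g \<circ> canonical_map r = canonical_map s \<circ> f"

text \<open>
  The set \<open>I\<close> attached to the i-kernel \<open>X0\<close>; \<^const>\<open>a_kernel\<close> is the preimage of the
  additive identity.
\<close>

definition i_kernel_ideal ::
  "('x \<times> 'x \<Rightarrow> 'x \<times> 'x) \<Rightarrow> 'x word set ring \<Rightarrow> 'u word set ring \<Rightarrow>
    ('x word set \<Rightarrow> 'u word set) \<Rightarrow> 'x set \<Rightarrow> 'x word set set" where
  "i_kernel_ideal r G H g X0 =
     generate G (canonical_map r ` X0) <#>\<^bsub>G\<^esub> a_kernel G H g"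

end

theory Submission
  imports Defs "HOL-Algebra.Elementary_Groups"
begin

text \<open>
  The defining property of an i-kernel \<open>X\<^sub>0\<close> says that \<open>X\<^sub>0\<close> is stable in \<open>G\<^sub>X\<close> under all
  \<open>\<lambda>\<^sub>a\<close> and under additive conjugation, because \<open>- \<lambda>\<^sub>a b + a + \<lambda>\<^sub>a b = \<lambda> (\<rho>\<^sub>b a)\<close> with the outer
  index \<open>\<lambda>\<^sub>a b\<close>. This gives the strong left ideal \<open>L\<close> generated by \<open>X\<^sub>0\<close>, and \<open>\<lambda>\<close>-stability lets
  sums of generators be rewritten as products. The set \<open>I\<close> is the preimage of the image of
  \<open>L\<close>, for either group operation. If \<open>u\<^sub>0\<close> is the value of \<open>f\<close> on \<open>X\<^sub>0\<close>, then
  \<open>s (u\<^sub>0, f x) = (f x, u\<^sub>0)\<close>, so the image of \<open>L\<close>, generated by \<open>u\<^sub>0\<close>, is central in the multiplicative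
  group of the image of \<open>G\<^sub>X\<close>, and \<open>I\<close> is an ideal. If \<open>x I = y I\<close>, then \<open>f x\<close> and \<open>f y\<close>
  differ in \<open>G\<^sub>U\<close> by a power of \<open>u\<^sub>0\<close>; the exponent vanishes because the defining relations of
  \<open>G\<^sub>U\<close> preserve the length of words.
\<close>

section \<open>Groups\<close>

text \<open>The centralizer of \<open>c\<close> is a subgroup, so it is enough that it contains the
  generators.\<close>

lemma (in group) generate_commute:
  assumes "A \<subseteq> carrier G" "c \<in> carrier G" "\<And>a. a \<in> A \<Longrightarrow> a \<otimes> c = c \<otimes> a"
    and "a \<in> generate G A"
  shows "a \<otimes> c = c \<otimes> a"
  using assms(4)
proof (induction rule: generate.induct)
  case one
  then show ?case using assms(2) by simp
next
  case (incl h)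
  then show ?case by (rule assms(3))
next
  case (inv h)
  then have h: "h \<in> carrier G" using assms(1) by blast
  have "inv h \<otimes> c = inv h \<otimes> (c \<otimes> h) \<otimes> inv h"
    using h assms(2) by (simp add: m_assoc)
  also have "\<dots> = inv h \<otimes> (h \<otimes> c) \<otimes> inv h"
    using assms(3)[OF inv] by simp
  also have "\<dots> = c \<otimes> inv h"
    using h assms(2) by (simp add: m_assoc[symmetric])
  finally show ?case .
next
  case (eng h1 h2)
  then have "h1 \<in> carrier G" "h2 \<in> carrier G"
    using assms(1) generate_in_carrier by blast+
  with eng.IH assms(2) show ?case by (metis m_assoc)
qed

text \<open>The setwise stabilizer of \<open>S\<close> under an action is a subgroup. The condition
  on \<open>T\<close> is an equality of sets, not an inclusion, so that it passes to inverses. The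
  action laws are asked only on \<open>D\<close>.\<close>

lemma (in group) generate_stabilizes:
  assumes "T \<subseteq> carrier G" "S \<subseteq> D"
    and one: "\<And>x. x \<in> D \<Longrightarrow> \<phi> \<one> x = x"
    and mult: "\<And>a b x. a \<in> carrier G \<Longrightarrow> b \<in> carrier G \<Longrightarrow> x \<in> D \<Longrightarrow> \<phi> (a \<otimes> b) x = \<phi> a (\<phi> b x)"
    and T: "\<And>t. t \<in> T \<Longrightarrow> \<phi> t ` S = S"
    and "a \<in> generate G T"
  shows "\<phi> a ` S = S"
  using assms(6)
proof (induction rule: generate.induct)
  case one
  then show ?case using assms(2) by (force simp: assms(3))
next
  case (incl h)
  then show ?case by (rule T)
next
  case (inv h)
  then have h: "h \<in> carrier G" using assms(1) by blast
  have "\<phi> (inv h) ` S = \<phi> (inv h) ` \<phi> h ` S"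
    by (simp add: T inv)
  also have "\<dots> = (\<lambda>x. x) ` S"
    unfolding image_image
  proof (rule image_cong[OF HOL.refl])
    fix x assume "x \<in> S"
    then have "x \<in> D" using assms(2) by blast
    then show "\<phi> (inv h) (\<phi> h x) = x"
      using mult[of "inv h" h x] one[of x] h by simp
  qed
  finally show ?case by simp
next
  case (eng h1 h2)
  then have h: "h1 \<in> carrier G" "h2 \<in> carrier G"
    using assms(1) generate_in_carrier by blast+
  have "\<phi> (h1 \<otimes> h2) ` S = \<phi> h1 ` \<phi> h2 ` S"
    unfolding image_image using h assms(2) by (intro image_cong) (auto simp: mult)
  with eng.IH show ?case by simp
qed

lemma (in group) l_coset_eq_iff:
  assumes "subgroup H G" "x \<in> carrier G" "y \<in> carrier G"
  shows "x <# H = y <# H \<longleftrightarrow> inv y \<otimes> x \<in> H"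
proof
  assume "x <# H = y <# H"
  moreover have "x \<in> x <# H"
    using subgroup.one_closed[OF assms(1)] assms(2) by (force simp: l_coset_def)
  ultimately obtain h where h: "h \<in> H" "x = y \<otimes> h"
    by (auto simp: l_coset_def)
  moreover have "h \<in> carrier G" using h(1) subgroup.mem_carrier[OF assms(1)] by blast
  ultimately show "inv y \<otimes> x \<in> H"
    using assms(3) by (simp flip: m_assoc)
next
  assume "inv y \<otimes> x \<in> H"
  then have "x \<in> y <# H"
    using assms(2,3) by (force simp: l_coset_def simp flip: m_assoc)
  then show "x <# H = y <# H"
    using l_repr_independence[OF _ assms(3,1)] by auto
qed

text \<open>Write \<open>a = l \<otimes> (inv l \<otimes> a)\<close>. The right-hand side does not
  involve the group operation, which later allows the product and the sum to be compared.\<close>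

lemma (in group_hom) set_mult_kernel_eq_vimage:
  assumes "L \<subseteq> carrier G"
  shows "L <#> kernel G H h = {a \<in> carrier G. h a \<in> h ` L}"
proof (intro equalityI subsetI)
  fix a assume "a \<in> L <#> kernel G H h"
  then obtain l k where "l \<in> L" "k \<in> carrier G" "h k = \<one>\<^bsub>H\<^esub>" "a = l \<otimes> k"
    by (auto simp: set_mult_def kernel_def)
  with assms show "a \<in> {a \<in> carrier G. h a \<in> h ` L}"
    by (auto simp: subset_iff)
next
  fix a assume "a \<in> {a \<in> carrier G. h a \<in> h ` L}"
  then obtain l where *: "a \<in> carrier G" "l \<in> L" "h a = h l" by blast
  with assms have "l \<in> carrier G" by blast
  with * have "inv l \<otimes> a \<in> kernel G H h" "a = l \<otimes> (inv l \<otimes> a)"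
    by (simp_all add: kernel_def G.m_assoc[symmetric])
  with * show "a \<in> L <#> kernel G H h"
    unfolding set_mult_def by blast
qed

lemma (in group_hom) vimage_image_subgroup:
  assumes "subgroup L G"
  shows "subgroup {a \<in> carrier G. h a \<in> h ` L} G"
proof -
  interpret M: subgroup "h ` L" H by (rule subgroup_img_is_subgroup[OF assms])
  show ?thesis
    by (rule G.subgroupI) (auto simp del: image_iff intro: M.m_closed M.m_inv_closed M.one_closed
        intro!: exI[of _ "\<one>"])
qed

text \<open>Conjugates of elements of \<open>L\<close> have to lie in \<open>L\<close> only modulo
  the kernel; this is what centrality of the image of \<open>L\<close> will supply.\<close>

lemma (in group_hom) vimage_image_normal:
  assumes "subgroup L G"
    and "\<And>a l. a \<in> carrier G \<Longrightarrow> l \<in> L \<Longrightarrow> h (a \<otimes> l \<otimes> inv a) \<in> h ` L"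
  shows "{a \<in> carrier G. h a \<in> h ` L} \<lhd> G"
  unfolding G.normal_inv_iff
proof (intro conjI ballI vimage_image_subgroup assms(1))
  fix a b assume a: "a \<in> carrier G" and "b \<in> {a \<in> carrier G. h a \<in> h ` L}"
  then obtain l where b: "b \<in> carrier G" "l \<in> L" "h b = h l" by blast
  then have "l \<in> carrier G" using subgroup.mem_carrier[OF assms(1)] by blast
  with a b assms(2)[of a l] show "a \<otimes> b \<otimes> inv a \<in> {a \<in> carrier G. h a \<in> h ` L}"
    by simp
qed


section \<open>Skew braces\<close>

locale brace =
  fixes B (structure)
  assumes brace: "skew_brace B"

sublocale brace \<subseteq> group B
  using brace by (simp add: skew_brace_def)

sublocale brace \<subseteq> A: group "add_monoid B"
  rewrites "carrier (add_monoid B) = carrier B"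
    and "mult (add_monoid B) = add B"
    and "one (add_monoid B) = zero B"
    and "m_inv (add_monoid B) = a_inv B"
  using brace by (simp_all add: skew_brace_def a_inv_def)

context brace
begin

abbreviation lam :: "'a \<Rightarrow> 'a \<Rightarrow> 'a" where
  "lam \<equiv> brace_lambda B"

lemma zero_eq_one: "\<zero> = \<one>"
proof -
  \<comment> \<open>The brace law at \<open>a = \<one>\<close> and
    \<open>b = c = \<zero>\<close>.\<close>
  have "\<one> \<otimes> (\<zero> \<oplus> \<zero>) = (\<one> \<otimes> \<zero>) \<ominus> \<one> \<oplus> (\<one> \<otimes> \<zero>)"
    using brace A.one_closed one_closed by (simp only: skew_brace_def)
  then have "\<zero> = \<ominus> \<one>" by (simp add: a_minus_def)
  then show ?thesis by (metis A.inv_inv A.inv_one one_closed)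
qed

lemma lam_closed [simp]: "a \<in> carrier B \<Longrightarrow> b \<in> carrier B \<Longrightarrow> lam a b \<in> carrier B"
  by (simp add: brace_lambda_def)

lemma mult_eq: "a \<in> carrier B \<Longrightarrow> b \<in> carrier B \<Longrightarrow> a \<otimes> b = a \<oplus> lam a b"
  by (simp add: brace_lambda_def A.m_assoc[symmetric])

lemma mult_eq_rho: "a \<in> carrier B \<Longrightarrow> b \<in> carrier B \<Longrightarrow> a \<otimes> b = lam a b \<otimes> brace_rho B b a"
  by (simp add: brace_rho_def m_assoc[symmetric])

lemma lam_add:
  assumes "a \<in> carrier B" "b \<in> carrier B" "c \<in> carrier B"
  shows "lam a (b \<oplus> c) = lam a b \<oplus> lam a c"
proof -
  have "a \<otimes> (b \<oplus> c) = (a \<otimes> b) \<ominus> a \<oplus> (a \<otimes> c)"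
    using brace assms by (simp add: skew_brace_def)
  with assms show ?thesis
    by (simp add: brace_lambda_def a_minus_def A.m_assoc)
qed

text \<open>Expand \<open>a \<otimes> (b \<otimes> c)\<close> in two ways by \<open>mult_eq\<close>
  and cancel \<open>a \<otimes> b\<close> additively. Thus \<open>lam\<close> is an action of the
  multiplicative group.\<close>

lemma lam_mult:
  assumes "a \<in> carrier B" "b \<in> carrier B" "c \<in> carrier B"
  shows "lam (a \<otimes> b) c = lam a (lam b c)"
proof -
  have "(a \<otimes> b) \<oplus> lam (a \<otimes> b) c = a \<otimes> (b \<otimes> c)"
    using assms by (simp add: mult_eq[symmetric] m_assoc)
  also have "\<dots> = a \<oplus> lam a (b \<oplus> lam b c)"
    using assms by (simp add: mult_eq)
  also have "\<dots> = (a \<otimes> b) \<oplus> lam a (lam b c)"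
    using assms by (simp add: lam_add A.m_assoc mult_eq)
  finally show ?thesis using assms by simp
qed

lemma lam_one: "b \<in> carrier B \<Longrightarrow> lam \<one> b = b"
  by (simp add: brace_lambda_def flip: zero_eq_one)

lemma lam_zero: "a \<in> carrier B \<Longrightarrow> lam a \<zero> = \<zero>"
  by (simp add: brace_lambda_def zero_eq_one)

lemma lam_minus:
  assumes "a \<in> carrier B" "b \<in> carrier B"
  shows "lam a (\<ominus> b) = \<ominus> lam a b"
  using assms lam_add[of a "\<ominus> b" b] lam_zero[of a] by (simp add: A.inv_equality)

text \<open>This is \<open>\<zero> = inv a \<otimes> a = inv a \<oplus> lam (inv a) a\<close>. In a
  \<open>lam\<close>-stable set it turns multiplicative inverses into additive inverses.\<close>

lemma inv_eq: "a \<in> carrier B \<Longrightarrow> inv a = \<ominus> lam (inv a) a"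
  using mult_eq[of "inv a" a] by (simp add: A.inv_equality zero_eq_one)

lemma lam_lam_inv:
  assumes "a \<in> carrier B" "b \<in> carrier B"
  shows "lam a (lam (inv a) b) = b"
  using assms lam_mult[of a "inv a" b] by (simp add: lam_one)

lemma add_eq: "a \<in> carrier B \<Longrightarrow> b \<in> carrier B \<Longrightarrow> a \<oplus> b = a \<otimes> lam (inv a) b"
  by (simp add: mult_eq lam_lam_inv)

text \<open>Comparing the two expressions \<open>a + \<lambda>\<^sub>a b\<close> and \<open>\<lambda>\<^sub>a b + \<lambda> (\<rho>\<^sub>b a)\<close> of \<open>a b\<close> expresses additive
  conjugation by the solution.\<close>

lemma add_conj_eq:
  assumes "a \<in> carrier B" "b \<in> carrier B"
  shows "\<ominus> lam a b \<oplus> a \<oplus> lam a b = lam (lam a b) (brace_rho B b a)"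
proof -
  have "brace_rho B b a \<in> carrier B" using assms by (simp add: brace_rho_def)
  moreover have "a \<oplus> lam a b = lam a b \<oplus> lam (lam a b) (brace_rho B b a)"
    using assms calculation mult_eq_rho[of a b] by (simp add: mult_eq)
  ultimately show ?thesis using assms by (simp add: A.m_assoc A.inv_solve_left')
qed

section \<open>Subgroups generated by a \<open>lam\<close>-stable set\<close>

context
  fixes S
  assumes S: "S \<subseteq> carrier B"
    and lam_S: "\<And>a. a \<in> carrier B \<Longrightarrow> lam a ` S \<subseteq> S"
begin

lemma lam_generate_add:
  assumes "a \<in> carrier B" "b \<in> generate (add_monoid B) S"
  shows "lam a b \<in> generate (add_monoid B) S"
  using assms(2)
proof (induction rule: generate.induct)
  case one
  then show ?case using generate.one[of "add_monoid B" S] by (simp add: lam_zero assms)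
next
  case (incl h)
  then show ?case using lam_S[OF assms(1)] by (blast intro: generate.incl)
next
  case (inv h)
  then have "h \<in> carrier B" "lam a h \<in> S" using S lam_S[OF assms(1)] by blast+
  then show ?case
    using generate.inv[of "lam a h" S "add_monoid B"] assms
    by (simp add: lam_minus flip: a_inv_def)
next
  case (eng h1 h2)
  then have "h1 \<in> carrier B" "h2 \<in> carrier B"
    using S A.generate_in_carrier by blast+
  with eng assms show ?case
    using generate.eng[of "lam a h1" "add_monoid B" S "lam a h2"] by (simp add: lam_add)
qed

lemma left_ideal_generate_add: "left_ideal B (generate (add_monoid B) S)"
  using lam_generate_add A.generate_is_subgroup[of S] S by (auto simp: left_ideal_def)

text \<open>Products become sums by \<open>mult_eq\<close> and sums become products by
  \<open>add_eq\<close>, at the cost of some \<open>lam a\<close>, which maps \<open>S\<close> into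
  itself.\<close>

lemma generate_mult_eq_generate_add: "generate B S = generate (add_monoid B) S"
proof
  show "generate B S \<subseteq> generate (add_monoid B) S"
  proof
    fix a assume "a \<in> generate B S"
    then show "a \<in> generate (add_monoid B) S"
    proof (induction rule: generate.induct)
      case one
      then show ?case using generate.one[of "add_monoid B" S] by (simp add: zero_eq_one)
    next
      case (incl h)
      then show ?case by (rule generate.incl)
    next
      case (inv h)
      then have "h \<in> carrier B" using S by blast
      then show ?case
        using inv lam_S[of "inv h"] generate.inv[of "lam (inv h) h" S "add_monoid B"] inv_eq[of h]
        by (auto simp flip: a_inv_def)
    next
      case (eng h1 h2)
      then have "h1 \<in> carrier B" "h2 \<in> carrier B"
        using S generate_in_carrier by blast+
      with eng show ?case
        using generate.eng[of h1 "add_monoid B" S "lam h1 h2"] by (simp add: mult_eq lam_generate_add)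
    qed
  qed
next
  \<comment> \<open>The summand \<open>m\<close> is a partial sum already known to lie in
    \<open>generate B S\<close>. It is arbitrary in the induction because
    \<open>h1 \<oplus> h2\<close> is absorbed in two steps; the inclusion is the case
    \<open>m = \<one>\<close>.\<close>
  have add: "m \<oplus> a \<in> generate B S"
    if "a \<in> generate (add_monoid B) S" "m \<in> generate B S" for a m
    using that
  proof (induction arbitrary: m rule: generate.induct)
    case one
    then have "m \<in> carrier B" using S generate_in_carrier by blast
    with one show ?case by simp
  next
    case (incl h)
    then have "m \<in> carrier B" "h \<in> carrier B" using S generate_in_carrier by blast+
    moreover from this have "lam (inv m) h \<in> S" using incl lam_S[of "inv m"] by auto
    ultimately show ?case
      using incl by (simp add: add_eq generate.eng generate.incl)
  next
    case (inv h)
    then have mh: "m \<in> carrier B" "h \<in> carrier B" using S generate_in_carrier by blast+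
    \<comment> \<open>The difference \<open>n\<close> satisfies
      \<open>m = n \<oplus> h = n \<otimes> h'\<close> with \<open>h'\<close> again in
      \<open>S\<close>, hence \<open>n = m \<otimes> inv h'\<close>.\<close>
    define n where "n = m \<ominus> h"
    have n: "n \<in> carrier B" using mh by (simp add: n_def a_minus_def)
    define h' where "h' = lam (inv n) h"
    have h': "h' \<in> S" using lam_S[of "inv n"] n inv by (auto simp: h'_def)
    have "m = n \<oplus> h" using mh by (simp add: n_def a_minus_def A.m_assoc)
    then have "m = n \<otimes> h'" using n mh by (simp add: add_eq h'_def)
    then have "n = m \<otimes> inv h'" using n h' S by (simp add: m_assoc subset_iff)
    then have "n \<in> generate B S" using inv.prems h' by (simp add: generate.eng generate.inv)
    then show ?case by (simp add: n_def a_minus_def a_inv_def)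
  next
    case (eng h1 h2)
    then have "m \<in> carrier B" "h1 \<in> carrier B" "h2 \<in> carrier B"
      using S A.generate_in_carrier generate_in_carrier by blast+
    with eng show ?case by (simp flip: A.m_assoc)
  qed
  show "generate (add_monoid B) S \<subseteq> generate B S"
  proof
    fix a assume a: "a \<in> generate (add_monoid B) S"
    then have "a \<in> carrier B" using S A.generate_in_carrier by blast
    then show "a \<in> generate B S"
      using add[OF a generate.one] by (simp flip: zero_eq_one)
  qed
qed

end

lemma lam_image_eq:
  assumes "T \<subseteq> carrier B" "generate B T = carrier B" "S \<subseteq> carrier B"
    and "\<And>t. t \<in> T \<Longrightarrow> lam t ` S = S" "a \<in> carrier B"
  shows "lam a ` S = S"
  by (rule generate_stabilizes[where T = T and D = "carrier B" and \<phi> = lam])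
    (use assms in \<open>auto simp: lam_one lam_mult\<close>)

text \<open>Conjugation is an action of the additive group, so stability of \<open>S\<close> under
  the additive generators \<open>T\<close> extends to the whole carrier, and a conjugation-stable
  set generates a normal subgroup.\<close>

lemma strong_left_ideal_generate_add:
  assumes T: "T \<subseteq> carrier B" "generate (add_monoid B) T = carrier B"
    and S: "S \<subseteq> carrier B" "\<And>a. a \<in> carrier B \<Longrightarrow> lam a ` S \<subseteq> S"
    and conj: "\<And>t. t \<in> T \<Longrightarrow> (\<lambda>s. \<ominus> t \<oplus> s \<oplus> t) ` S = S"
  shows "strong_left_ideal B (generate (add_monoid B) S)"
proof -
  have "(\<lambda>s. a \<oplus> s \<oplus> \<ominus> a) ` S = S" if "a \<in> carrier B" for a
  proof (rule A.generate_stabilizes[where T = T and D = "carrier B"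
          and \<phi> = "\<lambda>a s. a \<oplus> s \<oplus> \<ominus> a"])
    fix t assume t: "t \<in> T"
    \<comment> \<open>The hypothesis \<open>conj\<close> concerns the inverse conjugation, which is
      therefore inserted first and then undone.\<close>
    have "(\<lambda>s. t \<oplus> s \<oplus> \<ominus> t) ` S = (\<lambda>s. t \<oplus> s \<oplus> \<ominus> t) ` (\<lambda>s. \<ominus> t \<oplus> s \<oplus> t) ` S"
      by (simp add: conj t)
    also have "\<dots> = (\<lambda>s. s) ` S"
      unfolding image_image
    proof (rule image_cong[OF HOL.refl])
      fix s assume "s \<in> S"
      with t T S have "t \<in> carrier B" "s \<in> carrier B" by auto
      then show "t \<oplus> (\<ominus> t \<oplus> s \<oplus> t) \<oplus> \<ominus> t = s"
        by (simp add: A.m_assoc) (simp flip: A.m_assoc)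
    qed
    finally show "(\<lambda>s. t \<oplus> s \<oplus> \<ominus> t) ` S = S" by simp
  qed (use T S that in \<open>auto simp: A.m_assoc A.inv_mult_group\<close>)
  then have "generate (add_monoid B) S \<lhd> add_monoid B"
    using S(1) by (intro A.normal_generateI) (auto simp: image_subset_iff set_eq_subset)
  with left_ideal_generate_add[OF S] show ?thesis
    by (simp add: strong_left_ideal_def)
qed

end


section \<open>Homomorphisms of skew braces\<close>

locale brace_pair = B: brace B + C: brace C for B (structure) and C (structure) +
  fixes g
  assumes g: "g \<in> brace_hom B C"

sublocale brace_pair \<subseteq> M: group_hom B C g
  using g by unfold_locales (simp add: brace_hom_def)

sublocale brace_pair \<subseteq> A: group_hom "add_monoid B" "add_monoid C" g
  using g by unfold_locales (simp add: brace_hom_def)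

context brace_pair
begin

lemma hom_add: "a \<in> carrier B \<Longrightarrow> b \<in> carrier B \<Longrightarrow> g (a \<oplus> b) = g a \<oplus>\<^bsub>C\<^esub> g b"
  using A.hom_mult[of a b] by simp

lemma hom_minus: "a \<in> carrier B \<Longrightarrow> g (\<ominus> a) = \<ominus>\<^bsub>C\<^esub> g a"
  using A.hom_inv[of a] by (simp add: a_inv_def)

lemma hom_lam:
  "a \<in> carrier B \<Longrightarrow> b \<in> carrier B \<Longrightarrow> g (brace_lambda B a b) = brace_lambda C (g a) (g b)"
  by (simp add: brace_lambda_def hom_add hom_minus)

text \<open>The additive and multiplicative identities of \<open>C\<close> coincide.\<close>

lemma a_kernel_eq_kernel: "a_kernel B C g = kernel B C g"
  by (simp add: a_kernel_def' kernel_def C.zero_eq_one)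

lemma set_mult_a_kernel:
  "L \<subseteq> carrier B \<Longrightarrow> L <#> a_kernel B C g = {a \<in> carrier B. g a \<in> g ` L}"
  by (simp add: a_kernel_eq_kernel M.set_mult_kernel_eq_vimage)

lemma set_add_a_kernel:
  "L \<subseteq> carrier B \<Longrightarrow> L <+> a_kernel B C g = {a \<in> carrier B. g a \<in> g ` L}"
  by (simp add: a_kernel_def set_add_def A.set_mult_kernel_eq_vimage)

text \<open>In the preimage description, additive normality and \<open>lam\<close>-stability are
  inherited from \<open>L\<close>, while multiplicative normality comes from \<open>commute\<close>:
  a conjugate of \<open>l\<close> has the same image as \<open>l\<close>.\<close>

lemma brace_ideal_set_mult_a_kernel:
  assumes L: "strong_left_ideal B L" "subgroup L B"
    and commute: "\<And>a l. a \<in> carrier B \<Longrightarrow> l \<in> L \<Longrightarrow> g a \<otimes>\<^bsub>C\<^esub> g l = g l \<otimes>\<^bsub>C\<^esub> g a"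
  shows "brace_ideal B (L <#> a_kernel B C g)"
proof -
  have sub: "L \<subseteq> carrier B" by (rule subgroup.subset[OF L(2)])
  interpret L: normal L "add_monoid B" using L(1) by (simp add: strong_left_ideal_def)
  let ?I = "{a \<in> carrier B. g a \<in> g ` L}"
  have "?I \<lhd> add_monoid B"
    using A.vimage_image_normal[OF L.subgroup_axioms] L.inv_op_closed2 by simp
  moreover have "brace_lambda B a ` ?I \<subseteq> ?I" if a: "a \<in> carrier B" for a
  proof (intro image_subsetI)
    fix b assume "b \<in> ?I"
    then obtain l where *: "b \<in> carrier B" "l \<in> L" "g b = g l" by blast
    then have "brace_lambda B a l \<in> L"
      using L(1) a by (auto simp: strong_left_ideal_def left_ideal_def)
    moreover have "g (brace_lambda B a b) = g (brace_lambda B a l)"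
      using * a sub by (simp add: hom_lam subset_iff)
    ultimately show "brace_lambda B a b \<in> ?I" using * a by simp
  qed
  moreover have "?I \<lhd> B"
  proof (rule M.vimage_image_normal[OF L(2)])
    fix a l assume al: "a \<in> carrier B" "l \<in> L"
    then have "l \<in> carrier B" using sub by blast
    with al have "g (a \<otimes> l \<otimes> inv a) = (g a \<otimes>\<^bsub>C\<^esub> g l) \<otimes>\<^bsub>C\<^esub> inv\<^bsub>C\<^esub> g a"
      by simp
    also have "\<dots> = g l"
      unfolding commute[OF al] using al \<open>l \<in> carrier B\<close> by (simp add: C.m_assoc)
    finally have "g (a \<otimes> l \<otimes> inv a) = g l" .
    with al show "g (a \<otimes> l \<otimes> inv a) \<in> g ` L" by simp
  qed
  ultimately show ?thesis
    by (simp add: set_mult_a_kernel[OF sub] brace_ideal_def strong_left_ideal_def left_ideal_def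
        normal_imp_subgroup)
qed

end


section \<open>Structure groups\<close>

text \<open>By the cancellation rule the letter \<open>(x, False)\<close> represents the inverse of
  a generator, so a word is a product of generators and their inverses.\<close>

lemma presented_group_generate:
  "generate (presented_group R) (range (\<lambda>x. word_class R [(x, True)])) = carrier (presented_group R)"
  (is "generate ?G ?S = _")
proof
  interpret group ?G by (rule group_presented_group)
  have one: "\<one>\<^bsub>?G\<^esub> = word_class R []" by (simp add: presented_group_def)
  have S: "?S \<subseteq> carrier ?G" by (auto simp: presented_group_def)
  then show "generate ?G ?S \<subseteq> carrier ?G" by (rule generate_incl)
  have letter: "word_class R [(x, b)] \<in> generate ?G ?S" for x b
  proof (cases b)
    case True
    then show ?thesis by (auto intro: generate.incl)
  next
    case False
    have "word_class R [(x, False)] \<otimes>\<^bsub>?G\<^esub> word_class R [(x, True)] = \<one>\<^bsub>?G\<^esub>"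
      using word_cong.cancel[of R x False]
      by (simp add: mult_word_class one word_class_eq_iff)
    then have "word_class R [(x, False)] = inv\<^bsub>?G\<^esub> word_class R [(x, True)]"
      by (intro inv_equality[symmetric]) (auto simp: presented_group_def)
    with False show ?thesis by (auto intro: generate.inv)
  qed
  have "word_class R w \<in> generate ?G ?S" for w
  proof (induction w)
    case Nil
    then show ?case using generate.one[of ?G ?S] by (simp add: one)
  next
    case (Cons a w)
    obtain x b where "a = (x, b)" by (cases a)
    with generate.eng[OF letter[of x b] Cons] show ?case by (simp add: mult_word_class)
  qed
  then show "carrier ?G \<subseteq> generate ?G ?S"
    by (auto simp: presented_group_def)
qed

section \<open>The degree (exponent sum) of words and of their classes\<close>

definition word_degree :: "'x word \<Rightarrow> int" where
  "word_degree w = (\<Sum>(x, b)\<leftarrow>w. if b then 1 else - 1)"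

text \<open>A cancelling pair has degree 0, and both sides of a defining relation have degree
  2.\<close>

lemma word_degree_cong:
  "word_cong (structure_relations r) u v \<Longrightarrow> word_degree u = word_degree v"
  by (induction rule: word_cong.induct) (auto simp: word_degree_def structure_relations_def)

text \<open>On classes modulo \<open>structure_relations r\<close> the chosen representative does
  not matter, by \<open>word_degree_cong\<close>. This holds for every \<open>r\<close>, so
  \<open>r\<close> is not a parameter.\<close>

definition degree :: "'x word set \<Rightarrow> int" where
  "degree A = word_degree (SOME w. w \<in> A)"

lemma degree_word_class: "degree (word_class (structure_relations r) w) = word_degree w"
proof -
  have "(SOME v. v \<in> word_class (structure_relations r) w) \<in> word_class (structure_relations r) w"
    by (rule someI[of _ w]) (simp add: word_class_def word_cong.refl)
  then show ?thesis
    using word_degree_cong by (fastforce simp: degree_def word_class_def)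
qed

lemma degree_canonical_map: "degree (canonical_map r x) = 1"
  by (simp add: canonical_map_def degree_word_class word_degree_def)

lemma degree_mult:
  assumes "A \<in> carrier (structure_group r)" "A' \<in> carrier (structure_group r)"
  shows "degree (A \<otimes>\<^bsub>structure_group r\<^esub> A') = degree A + degree A'"
proof -
  obtain u v where "A = word_class (structure_relations r) u" "A' = word_class (structure_relations r) v"
    using assms by (auto simp: structure_group_def presented_group_def)
  then show ?thesis
    by (simp add: structure_group_def mult_word_class degree_word_class word_degree_def)
qed

lemma yb_solution_bij:
  assumes "yb_solution r"
  shows "bij (sol_lambda r x)" "bij (sol_rho r x)"
  using assms by (auto simp: yb_solution_def)

section \<open>The structure skew brace and its canonical generators\<close>

locale structure_brace =
  fixes r :: "'x \<times> 'x \<Rightarrow> 'x \<times> 'x" and G :: "'x word set ring" (structure)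
  assumes solution: "yb_solution r" and structure_brace: "structure_skew_brace r G"

sublocale structure_brace \<subseteq> brace G
  using structure_brace by unfold_locales (simp add: structure_skew_brace_def)

context structure_brace
begin

abbreviation \<iota> :: "'x \<Rightarrow> 'x word set" where
  "\<iota> \<equiv> canonical_map r"

lemma truncate_eq: "monoid.truncate G = structure_group r"
  using structure_brace by (simp add: structure_skew_brace_def)

lemma carrier_eq: "carrier G = carrier (structure_group r)"
  and mult_structure: "mult G = mult (structure_group r)"
  and one_structure: "one G = one (structure_group r)"
  by (simp_all add: monoid.defs flip: truncate_eq)

lemma canonical_closed [simp]: "\<iota> x \<in> carrier G"
  by (simp add: carrier_eq structure_group_def presented_group_def canonical_map_def)

text \<open>A generated subgroup depends only on carrier, product and unit, which \<open>G\<close>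
  shares with the presented group.\<close>

lemma generate_canonical: "generate G (range \<iota>) = carrier G"
proof -
  have inv_structure: "m_inv G = m_inv (structure_group r)"
    by (simp add: m_inv_def carrier_eq mult_structure one_structure fun_eq_iff)
  have "a \<in> generate G (range \<iota>)" if "a \<in> generate (structure_group r) (range \<iota>)" for a
    using that
  proof (induction rule: generate.induct)
    case one
    then show ?case by (metis generate.one one_structure)
  next
    case (incl h)
    then show ?case by (rule generate.incl)
  next
    case (inv h)
    then show ?case by (metis generate.inv inv_structure)
  next
    case (eng h1 h2)
    then show ?case by (metis generate.eng mult_structure)
  qed
  moreover have "generate (structure_group r) (range \<iota>) = carrier G"
    using presented_group_generate[of "structure_relations r"]
    by (simp add: carrier_eq structure_group_def canonical_map_def[abs_def])
  moreover have "generate G (range \<iota>) \<subseteq> carrier G" by (rule generate_incl) auto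
  ultimately show ?thesis by blast
qed

lemma sol_canonical:
  "lam (\<iota> x) (\<iota> y) = \<iota> (sol_lambda r x y)"
  "brace_rho G (\<iota> y) (\<iota> x) = \<iota> (sol_rho r y x)"
proof -
  have "brace_sol G (map_prod \<iota> \<iota> (x, y)) = map_prod \<iota> \<iota> (r (x, y))"
    using structure_brace unfolding structure_skew_brace_def by (metis comp_apply)
  then show "lam (\<iota> x) (\<iota> y) = \<iota> (sol_lambda r x y)"
    "brace_rho G (\<iota> y) (\<iota> x) = \<iota> (sol_rho r y x)"
    by (simp_all add: brace_sol_def sol_lambda_def sol_rho_def prod_eq_iff)
qed

lemma canonical_mult: "\<iota> x \<otimes> \<iota> y = \<iota> (sol_lambda r x y) \<otimes> \<iota> (sol_rho r y x)"
  using mult_eq_rho[of "\<iota> x" "\<iota> y"] by (simp add: sol_canonical)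

lemma lam_image_canonical:
  assumes "\<And>x. sol_lambda r x ` S = S" "a \<in> carrier G"
  shows "lam a ` \<iota> ` S = \<iota> ` S"
proof (rule lam_image_eq[where T = "range \<iota>"])
  fix t assume "t \<in> range \<iota>"
  then obtain x where "t = \<iota> x" by blast
  then have "lam t ` \<iota> ` S = \<iota> ` sol_lambda r x ` S"
    by (simp add: image_image sol_canonical)
  with assms(1) show "lam t ` \<iota> ` S = \<iota> ` S" by simp
qed (use assms generate_canonical in auto)

text \<open>Each \<open>sol_lambda r x\<close> is onto, so the canonical image is
  \<open>lam\<close>-stable and generates the same subgroup for both operations.\<close>

lemma generate_add_canonical: "generate (add_monoid G) (range \<iota>) = carrier G"
proof -
  have "sol_lambda r x ` UNIV = UNIV" for x
    using yb_solution_bij(1)[OF solution] by (simp add: bij_is_surj)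
  then have "lam a ` range \<iota> \<subseteq> range \<iota>" if "a \<in> carrier G" for a
    using lam_image_canonical[of UNIV a] that by blast
  then have "generate G (range \<iota>) = generate (add_monoid G) (range \<iota>)"
    by (intro generate_mult_eq_generate_add) auto
  then show ?thesis by (simp only: generate_canonical)
qed

lemma degree_mult_closed:
  "a \<in> carrier G \<Longrightarrow> b \<in> carrier G \<Longrightarrow> degree (a \<otimes> b) = degree a + degree b"
  using degree_mult[of a r b] by (simp only: carrier_eq mult_structure)

lemma group_hom_degree: "group_hom G integer_group degree"
proof -
  have "degree \<in> hom G integer_group" by (simp add: hom_def degree_mult_closed)
  then show ?thesis
    by (rule group_hom.intro[OF is_group group_integer_group group_hom_axioms.intro])
qed

lemma degree_inv: "a \<in> carrier G \<Longrightarrow> degree (inv a) = - degree a"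
  using group_hom.hom_inv[OF group_hom_degree, of a] by simp

text \<open>The power of \<open>\<iota> x\<close> with exponent \<open>n\<close> has degree
  \<open>n\<close>.\<close>

lemma generate_canonical_degree_0:
  assumes "c \<in> generate G {\<iota> x}" "degree c = 0"
  shows "c = \<one>"
proof -
  obtain n :: int where n: "c = \<iota> x [^] n"
    using assms(1) unfolding generate_pow[OF canonical_closed] by blast
  have "degree c = degree (\<iota> x) [^]\<^bsub>integer_group\<^esub> n"
    unfolding n by (rule group_hom.hom_int_pow[OF group_hom_degree canonical_closed])
  then have "n = 0"
    using assms(2) by (simp add: degree_canonical_map)
  with n show ?thesis by simp
qed

end


section \<open>Kernels of i-homomorphisms\<close>

lemma sol_hom_lambda_rho:
  assumes "sol_hom r s f"
  shows "f (sol_lambda r x y) = sol_lambda s (f x) (f y)"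
    "f (sol_rho r y x) = sol_rho s (f y) (f x)"
proof -
  have "map_prod f f (r (x, y)) = s (f x, f y)"
    using fun_cong[OF assms[unfolded sol_hom_def], of "(x, y)"] by simp
  then show "f (sol_lambda r x y) = sol_lambda s (f x) (f y)"
    "f (sol_rho r y x) = sol_rho s (f y) (f x)"
    by (simp_all add: sol_lambda_def sol_rho_def prod_eq_iff)
qed

lemma ker_rel_classes: "UNIV // ker_rel f = range (\<lambda>z. {x. f x = f z})"
proof -
  have "ker_rel f `` {z} = {x. f x = f z}" for z
    by (auto simp: ker_rel_def)
  then show ?thesis by (auto simp: quotient_def)
qed

context
  fixes r :: "'x \<times> 'x \<Rightarrow> 'x \<times> 'x" and s :: "'u \<times> 'u \<Rightarrow> 'u \<times> 'u" and f X0 x0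
  assumes hom: "sol_hom r s f" and kernel: "i_kernel r f X0" and s: "yb_solution s"
    and r: "yb_solution r" and x0: "x0 \<in> X0"
begin

lemma i_kernel_eq: "X0 = {x. f x = f x0}"
  using kernel x0 by (auto simp: i_kernel_def ker_rel_classes)

lemma i_kernel_images:
  "r ` (X0 \<times> {x. f x = f z}) = {x. f x = f z} \<times> X0"
  "r ` ({x. f x = f z} \<times> X0) = X0 \<times> {x. f x = f z}"
  using kernel unfolding i_kernel_def ker_rel_classes by blast+

text \<open>The i-kernel condition fixes the classes of the components of \<open>r (x0, z)\<close>
  and \<open>r (z, x0)\<close>; applying \<open>f\<close> turns this into equations for
  \<open>s\<close>.\<close>

lemma i_kernel_trivial:
  "sol_lambda s (f x0) (f z) = f z" "sol_rho s (f z) (f x0) = f x0"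
  "sol_lambda s (f z) (f x0) = f x0"
proof -
  have "r (x0, z) \<in> {x. f x = f z} \<times> X0" "r (z, x0) \<in> X0 \<times> {x. f x = f z}"
    using x0 i_kernel_images[of z] by blast+
  then show "sol_lambda s (f x0) (f z) = f z" "sol_rho s (f z) (f x0) = f x0"
    "sol_lambda s (f z) (f x0) = f x0"
    unfolding sol_hom_lambda_rho[OF hom, symmetric] using i_kernel_eq
    by (auto simp: sol_lambda_def sol_rho_def mem_Times_iff)
qed

text \<open>The map \<open>sol_lambda s (f z)\<close> is injective and fixes \<open>f x0\<close>, so
  \<open>sol_lambda r z\<close> preserves membership in \<open>X0\<close> in both directions. Its
  surjectivity then gives equality of the sets.\<close>

lemma sol_lambda_i_kernel: "sol_lambda r z ` X0 = X0"
proof -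
  have mem: "y \<in> X0 \<longleftrightarrow> f y = f x0" for y
    by (subst i_kernel_eq) simp
  have "sol_lambda r z y \<in> X0 \<longleftrightarrow> y \<in> X0" for y
  proof -
    have "sol_lambda r z y \<in> X0 \<longleftrightarrow> sol_lambda s (f z) (f y) = sol_lambda s (f z) (f x0)"
      by (simp add: mem sol_hom_lambda_rho[OF hom] i_kernel_trivial)
    also have "\<dots> \<longleftrightarrow> f y = f x0"
      using yb_solution_bij(1)[OF s, of "f z"] by (simp add: bij_is_inj inj_eq)
    finally show ?thesis by (simp add: mem)
  qed
  then show ?thesis
    using bij_is_surj[OF yb_solution_bij(1)[OF r, of z]] by (auto simp: image_iff) (metis surjD)
qed

end

context structure_brace
begin

text \<open>By \<open>add_conj_eq\<close>, conjugating \<open>\<iota> a\<close> by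
  \<open>\<iota> y\<close> amounts to finding \<open>b\<close> with \<open>r (a, b) = (y, c)\<close>
  and then applying \<open>sol_lambda r y\<close> to \<open>c\<close>. Both operations respect
  \<open>X0\<close>.\<close>

lemma add_conj_i_kernel:
  assumes "sol_hom r s f" "i_kernel r f X0" "yb_solution s" "x0 \<in> X0"
  shows "(\<lambda>a. \<ominus> \<iota> y \<oplus> a \<oplus> \<iota> y) ` \<iota> ` X0 = \<iota> ` X0"
proof -
  note K = assms(1-3) solution assms(4)
  have conj: "\<ominus> \<iota> y \<oplus> \<iota> a \<oplus> \<iota> y = \<iota> (sol_lambda r y c)" if "r (a, b) = (y, c)" for a b c
    using add_conj_eq[of "\<iota> a" "\<iota> b"] that
    by (simp add: sol_canonical) (simp add: sol_lambda_def sol_rho_def)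
  have images: "r ` (X0 \<times> {x. f x = f y}) = {x. f x = f y} \<times> X0"
    by (rule i_kernel_images[OF K])
  show ?thesis
  proof (intro equalityI subsetI)
    fix t assume "t \<in> (\<lambda>a. \<ominus> \<iota> y \<oplus> a \<oplus> \<iota> y) ` \<iota> ` X0"
    then obtain a where a: "a \<in> X0" "t = \<ominus> \<iota> y \<oplus> \<iota> a \<oplus> \<iota> y" by blast
    obtain b where b: "sol_lambda r a b = y"
      using bij_is_surj[OF yb_solution_bij(1)[OF solution, of a]] by (metis surjD)
    have "f a = f x0" using a(1) i_kernel_eq[OF K] by blast
    then have "sol_rho s (f b) (f a) = f x0"
      by (simp add: i_kernel_trivial[OF K])
    then have "sol_rho r b a \<in> X0"
      using i_kernel_eq[OF K] by (simp add: sol_hom_lambda_rho[OF assms(1)])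
    then have "sol_lambda r y (sol_rho r b a) \<in> X0"
      using sol_lambda_i_kernel[OF K, of y] by blast
    moreover have "r (a, b) = (y, sol_rho r b a)"
      using b by (simp add: sol_lambda_def sol_rho_def prod_eq_iff)
    ultimately show "t \<in> \<iota> ` X0"
      unfolding a(2) by (simp only: conj imageI)
  next
    fix t assume "t \<in> \<iota> ` X0"
    then have "t \<in> \<iota> ` sol_lambda r y ` X0"
      unfolding sol_lambda_i_kernel[OF K] .
    then obtain c where c: "c \<in> X0" "t = \<iota> (sol_lambda r y c)" by blast
    \<comment> \<open>Here the i-kernel condition is used as surjectivity: \<open>(y, c)\<close>
      comes from a pair whose first component lies in \<open>X0\<close>.\<close>
    then have "(y, c) \<in> r ` (X0 \<times> {x. f x = f y})" by (simp add: images)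
    then obtain p where p: "(y, c) = r p" "p \<in> X0 \<times> {x. f x = f y}" by (rule imageE)
    obtain a b where "p = (a, b)" by (rule prod.exhaust)
    with p have "a \<in> X0" "r (a, b) = (y, c)" by simp_all
    moreover from this have "t = \<ominus> \<iota> y \<oplus> \<iota> a \<oplus> \<iota> y" using c(2) by (simp only: conj)
    ultimately show "t \<in> (\<lambda>a. \<ominus> \<iota> y \<oplus> a \<oplus> \<iota> y) ` \<iota> ` X0"
      unfolding image_image by (intro image_eqI)
  qed
qed

end

theorem theorem3p9:
  fixes r :: "'x \<times> 'x \<Rightarrow> 'x \<times> 'x"
    and s :: "'u \<times> 'u \<Rightarrow> 'u \<times> 'u"
    and f :: "'x \<Rightarrow> 'u"
    and X0 :: "'x set"
    and G_X :: "'x word set ring"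
    and G_U :: "'u word set ring"
    and fbar :: "'x word set \<Rightarrow> 'u word set"
  assumes "yb_solution r"
    and "yb_solution s"
    and "i_hom r s f"
    and "i_kernel r f X0"
    and "structure_skew_brace r G_X"
    and "structure_skew_brace s G_U"
    and "induced_hom r s G_X G_U f fbar"
  shows
    "(generate G_X (canonical_map r ` X0) = generate (add_monoid G_X) (canonical_map r ` X0) \<and>
      strong_left_ideal G_X (generate G_X (canonical_map r ` X0))) \<and>
     (i_kernel_ideal r G_X G_U fbar X0 =
        generate (add_monoid G_X) (canonical_map r ` X0) <+>\<^bsub>G_X\<^esub> a_kernel G_X G_U fbar \<and>
      brace_ideal G_X (i_kernel_ideal r G_X G_U fbar X0)) \<and>
     (\<forall>x y. f x = f y \<longrightarrow>
        canonical_map r x <#\<^bsub>G_X\<^esub> i_kernel_ideal r G_X G_U fbar X0 =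
        canonical_map r y <#\<^bsub>G_X\<^esub> i_kernel_ideal r G_X G_U fbar X0) \<and>
     (inj (canonical_map s) \<longrightarrow>
      (\<forall>x y. canonical_map r x <#\<^bsub>G_X\<^esub> i_kernel_ideal r G_X G_U fbar X0 =
             canonical_map r y <#\<^bsub>G_X\<^esub> i_kernel_ideal r G_X G_U fbar X0 \<longrightarrow>
             f x = f y))"
proof -
  interpret X: structure_brace r G_X using assms by unfold_locales
  interpret U: structure_brace s G_U using assms by unfold_locales
  interpret brace_pair G_X G_U fbar
    using assms(7) by unfold_locales (simp add: induced_hom_def)
  have hom: "sol_hom r s f" using assms(3) by (simp add: i_hom_def)
  have fbar: "fbar (X.\<iota> x) = U.\<iota> (f x)" for x
    using assms(7) by (metis induced_hom_def comp_apply)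
  obtain x0 where x0: "x0 \<in> X0"
    using assms(4) by (auto simp: i_kernel_def ker_rel_classes)
  note K = hom assms(4,2,1) x0
  let ?S = "X.\<iota> ` X0"
  let ?L = "generate G_X ?S"
  let ?I = "i_kernel_ideal r G_X G_U fbar X0"
  have S: "?S \<subseteq> carrier G_X" by auto
  have lam_S: "brace_lambda G_X a ` ?S \<subseteq> ?S" if "a \<in> carrier G_X" for a
    using X.lam_image_canonical[of X0 a] sol_lambda_i_kernel[OF K] that by simp
  have L_eq: "?L = generate (add_monoid G_X) ?S"
    by (rule X.generate_mult_eq_generate_add[OF S lam_S])
  have L_ideal: "strong_left_ideal G_X ?L"
    unfolding L_eq
  proof (rule X.strong_left_ideal_generate_add[OF _ X.generate_add_canonical S lam_S])
    show "range X.\<iota> \<subseteq> carrier G_X" by auto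
    fix t assume "t \<in> range X.\<iota>"
    then show "(\<lambda>a. \<ominus>\<^bsub>G_X\<^esub> t \<oplus>\<^bsub>G_X\<^esub> a \<oplus>\<^bsub>G_X\<^esub> t) ` ?S = ?S"
      using X.add_conj_i_kernel[OF hom assms(4,2) x0] by blast
  qed
  have L_subgroup: "subgroup ?L G_X" by (rule X.generate_is_subgroup[OF S])
  have L_sub: "?L \<subseteq> carrier G_X" by (rule subgroup.subset[OF L_subgroup])
  \<comment> \<open>Since \<open>X0\<close> is a single class of \<open>ker_rel f\<close>, the image
    of \<open>?L\<close> is cyclic.\<close>
  have "f ` X0 = {f x0}"
    using x0 i_kernel_eq[OF K] by auto
  moreover have "fbar ` ?S = U.\<iota> ` f ` X0"
    by (simp add: image_image fbar)
  ultimately have fbar_L: "fbar ` ?L = generate G_U {U.\<iota> (f x0)}"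
    using M.generate_img[OF S] by simp
  have commute: "fbar a \<otimes>\<^bsub>G_U\<^esub> fbar l = fbar l \<otimes>\<^bsub>G_U\<^esub> fbar a"
    if "a \<in> carrier G_X" "l \<in> ?L" for a l
  proof -
    have "generate G_U (fbar ` range X.\<iota>) = fbar ` generate G_X (range X.\<iota>)"
      by (rule M.generate_img) auto
    then have range: "fbar a \<in> generate G_U (fbar ` range X.\<iota>)"
      unfolding X.generate_canonical using that(1) by blast
    have l: "fbar l \<in> generate G_U {U.\<iota> (f x0)}" using that(2) fbar_L by blast
    \<comment> \<open>Since \<open>s (f x0, f x) = (f x, f x0)\<close>, the defining relation for
      this pair of generators is a commutation rule.\<close>
    have *: "U.\<iota> (f x0) \<otimes>\<^bsub>G_U\<^esub> U.\<iota> (f x) = U.\<iota> (f x) \<otimes>\<^bsub>G_U\<^esub> U.\<iota> (f x0)" for x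
      using U.canonical_mult[of "f x0" "f x"] by (simp add: i_kernel_trivial[OF K])
    \<comment> \<open>Commutation is extended twice: first from the generator of the image of
      \<open>?L\<close> to \<open>fbar l\<close>, then from the canonical generators to
      \<open>fbar a\<close>.\<close>
    have "fbar l \<otimes>\<^bsub>G_U\<^esub> U.\<iota> (f x) = U.\<iota> (f x) \<otimes>\<^bsub>G_U\<^esub> fbar l" for x
      by (rule U.generate_commute[OF _ _ _ l]) (auto simp: *)
    moreover have "fbar l \<in> carrier G_U" using that(2) L_sub by auto
    ultimately show ?thesis
      by (intro U.generate_commute[OF _ _ _ range]) (auto simp: fbar)
  qed
  have I_eq: "?I = {a \<in> carrier G_X. fbar a \<in> fbar ` ?L}"
    by (simp add: i_kernel_ideal_def set_mult_a_kernel[OF L_sub])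
  \<comment> \<open>The product and the sum with the kernel are the same preimage of the image of
    \<open>?L\<close>.\<close>
  have I_add: "?I = generate (add_monoid G_X) ?S <+>\<^bsub>G_X\<^esub> a_kernel G_X G_U fbar"
    using set_add_a_kernel[OF L_sub] by (simp add: I_eq L_eq)
  have I_ideal: "brace_ideal G_X ?I"
    unfolding i_kernel_ideal_def
    by (rule brace_ideal_set_mult_a_kernel[OF L_ideal L_subgroup commute])
  have I_subgroup: "subgroup ?I G_X"
    using I_ideal by (simp add: brace_ideal_def normal_imp_subgroup)
  \<comment> \<open>Because \<open>?I\<close> is a preimage under \<open>fbar\<close>, equality of
    cosets can be tested in \<open>G_U\<close>.\<close>
  have coset: "X.\<iota> x <#\<^bsub>G_X\<^esub> ?I = X.\<iota> y <#\<^bsub>G_X\<^esub> ?I \<longleftrightarrow>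
      inv\<^bsub>G_U\<^esub> U.\<iota> (f y) \<otimes>\<^bsub>G_U\<^esub> U.\<iota> (f x) \<in> generate G_U {U.\<iota> (f x0)}" for x y
    by (simp add: X.l_coset_eq_iff[OF I_subgroup]) (simp add: I_eq fbar_L fbar)
  have item3: "X.\<iota> x <#\<^bsub>G_X\<^esub> ?I = X.\<iota> y <#\<^bsub>G_X\<^esub> ?I" if "f x = f y" for x y
    using that by (simp add: coset generate.one)
  have item4: "f x = f y" if "inj U.\<iota>" "X.\<iota> x <#\<^bsub>G_X\<^esub> ?I = X.\<iota> y <#\<^bsub>G_X\<^esub> ?I" for x y
  proof -
    let ?c = "inv\<^bsub>G_U\<^esub> U.\<iota> (f y) \<otimes>\<^bsub>G_U\<^esub> U.\<iota> (f x)"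
    \<comment> \<open>Both generators have degree 1, so \<open>?c\<close> is an element of degree 0
      in a cyclic group in which only the identity has degree 0.\<close>
    have "degree ?c = 0" by (simp add: U.degree_mult_closed U.degree_inv degree_canonical_map)
    with that(2) have "?c = \<one>\<^bsub>G_U\<^esub>"
      using U.generate_canonical_degree_0 coset by blast
    then have "U.\<iota> (f x) = U.\<iota> (f y)"
      by (metis U.canonical_closed U.inv_closed U.inv_equality U.inv_inv)
    with that(1) show ?thesis by (simp add: inj_eq)
  qed
  show ?thesis
    by (intro conjI allI impI L_eq L_ideal I_add I_ideal) (rule item3 item4; assumption)+
qed

end
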